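(* Let $p,n\ge 2$ and $n_1\ge 1$ be integers with $p\le n$ and $n_1\le n$, and let $k=2^{n-n_1}$. Let $G=K_{2^{n-p},2^{n-p},\ldots,2^{n-p}}$ be the complete $2^p$-partite graph on $2^n$ vertices, labeled by $1,\ldots,2^n$ so that its parts are the residue classes modulo $2^p$. Let $H=ST_{n_1}^k$ be the $k$-rooted sibling tree, formed from $1$-rooted sibling trees $ST_{n_1}^{1,1},\ldots,ST_{n_1}^{1,k}$ (in the order in which their roots are joined), where for each $1\le i\le k$ the vertices of $ST_{n_1}^{1,i}$ are labeled by $(i-1)2^{n_1}+1,\ldots,i2^{n_1}$ according to the sibling tree traversal. Let $f:G\to H$ be the embedding that maps the vertex of $G$ labeled $x$ to the vertex of $H$ labeled $x$, for every $x$, and assigns to each edge $ab$ of $G$ a shortest path $P_f(ab)$ in $H$ between $f(a)$ and $f(b)$. Then $f$ induces the minimum wirelength $WL(G,H)$, i.e. $WL_f(G,H)=WL(G,H)$.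
   Context: All graphs are finite and simple. An embedding $f$ of a graph $G$ into a graph $H$ is an injective map $f:V(G)\to V(H)$ together with, for each edge $e=xy$ of $G$, a path $P_f(e)$ in $H$ between $f(x)$ and $f(y)$ (not necessarily shortest). Its wirelength $WL_f(G,H)$ is the sum over $e\in E(G)$ of the length of $P_f(e)$. The wirelength of $G$ into $H$ is $WL(G,H)=\min_f WL_f(G,H)$, over all embeddings $f$ of $G$ into $H$. The complete $2^p$-partite graph $K_{2^{n-p},\ldots,2^{n-p}}$ has its vertex set partitioned into $2^p$ independent sets (parts), each of size $2^{n-p}$, with all possible edges between vertices in different parts. The complete binary tree $T_m$ is the rooted binary tree with $m$ levels, level $i$ ($1\le i\le m$) containing $2^{i-1}$ vertices, in which each internal vertex has exactly two children (left and right) and all leaves are on level $m$; it has $2^m-1$ vertices. The $1$-rooted complete binary tree $T_m^1$ is obtained from $T_m$ by attaching a pendant edge to its root; the new vertex is the root of $T_m^1$. The $1$-rooted sibling tree $ST_m^1$ is obtained from $T_m^1$ by adding an edge (sibling edge) between the left and right children of each common parent; it has $2^m$ vertices. The $k$-rooted sibling tree $ST_m^k$ is obtained from $k$ vertex-disjoint copies $ST_m^{1,1},\ldots,ST_m^{1,k}$ of $ST_m^1$, with roots $r_1,\ldots,r_k$, by adding the edges $r_ir_{i+1}$, $1\le i\le k-1$. Sibling tree traversal: starting from the root, traverse the tree counterclockwise as in an ordinary binary tree traversal, but without cutting any region, i.e. traveling along sibling edges: from an internal vertex one goes down to the left child, around the left child's subtree, along the sibling edge to the right child, around the right child's subtree,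 and then back up to the internal vertex. Leaves are listed the first time they are passed and interior vertices the second time; thus, recursively, the left subtree is listed, then the right subtree, then the parent, and the root of $ST_m^1$ is listed last. *)

theory Defs
  imports Main "HOL-Library.Disjoint_Sets"
begin

record 'a graph =
  verts :: "'a set"
  edges :: "'a set set"

definition simple_graph :: "'a graph \<Rightarrow> bool" where
  "simple_graph G \<longleftrightarrow> finite (verts G) \<and> (\<forall>e\<in>edges G. e \<subseteq> verts G \<and> card e = 2)"


subsection \<open>Paths, embeddings and wirelength\<close>

text \<open>Paths are given by their vertex sequence. Since edges are unordered, a path
  between \<open>a\<close> and \<open>b\<close> may be listed from either end.\<close>

definition path :: "'a graph \<Rightarrow> 'a list \<Rightarrow> bool" where
  "path G p \<longleftrightarrow> p \<noteq> [] \<and> distinct p \<and> set p \<subseteq> verts G \<and>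
     successively (\<lambda>u v. {u, v} \<in> edges G) p"

definition path_length :: "'a list \<Rightarrow> nat" where
  "path_length p = length p - 1"

definition path_between :: "'a graph \<Rightarrow> 'a \<Rightarrow> 'a \<Rightarrow> 'a list \<Rightarrow> bool" where
  "path_between G a b p \<longleftrightarrow> path G p \<and>
     (hd p = a \<and> last p = b \<or> hd p = b \<and> last p = a)"

definition shortest_path_between :: "'a graph \<Rightarrow> 'a \<Rightarrow> 'a \<Rightarrow> 'a list \<Rightarrow> bool" where
  "shortest_path_between G a b p \<longleftrightarrow> path_between G a b p \<and>
     (\<forall>q. path_between G a b q \<longrightarrow> path_length p \<le> path_length q)"

definition embedding ::
  "'a graph \<Rightarrow> 'b graph \<Rightarrow> ('a \<Rightarrow> 'b) \<Rightarrow> ('a set \<Rightarrow> 'b list) \<Rightarrow> bool" where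
  "embedding G H f P \<longleftrightarrow> inj_on f (verts G) \<and> f ` verts G \<subseteq> verts H \<and>
     (\<forall>x y. {x, y} \<in> edges G \<longrightarrow> path_between H (f x) (f y) (P {x, y}))"

text \<open>The wirelength of an embedding depends on the map \<open>f\<close> only through the paths.\<close>

definition embedding_wirelength :: "'a graph \<Rightarrow> ('a set \<Rightarrow> 'b list) \<Rightarrow> nat" where
  "embedding_wirelength G P = (\<Sum>e\<in>edges G. path_length (P e))"

definition wirelength :: "'a graph \<Rightarrow> 'b graph \<Rightarrow> nat" where
  "wirelength G H =
     (LEAST w. \<exists>(f :: 'a \<Rightarrow> 'b) P. embedding G H f P \<and> embedding_wirelength G P = w)"


subsection \<open>Complete multipartite graphs\<close>

definition complete_multipartite :: "'a graph \<Rightarrow> 'a set set \<Rightarrow> bool" where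
  "complete_multipartite G Q \<longleftrightarrow> finite (verts G) \<and> partition_on (verts G) Q \<and>
     edges G = {{u, v} | u v. u \<in> verts G \<and> v \<in> verts G \<and> \<not> (\<exists>A\<in>Q. u \<in> A \<and> v \<in> A)}"


subsection \<open>Sibling trees\<close>

text \<open>A vertex of the complete binary tree with \<open>m\<close> levels is the word of left (\<open>False\<close>)
  and right (\<open>True\<close>) turns leading to it from the root \<open>[]\<close>; the word \<open>w\<close> is on level
  \<open>length w + 1\<close>.\<close>

definition complete_binary_tree :: "nat \<Rightarrow> bool list graph" where
  "complete_binary_tree m =
     \<lparr>verts = {w. length w < m},
      edges = {{w, w @ [b]} | w b. length w + 1 < m}\<rparr>"

text \<open>\<open>None\<close> is the new root. The constructions are meant for \<open>m \<ge> 1\<close>.\<close>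

definition rooted_binary_tree :: "nat \<Rightarrow> bool list option graph" where
  "rooted_binary_tree m =
     \<lparr>verts = insert None (Some ` verts (complete_binary_tree m)),
      edges = insert {None, Some []} ((`) Some ` edges (complete_binary_tree m))\<rparr>"

definition sibling_tree :: "nat \<Rightarrow> bool list option graph" where
  "sibling_tree m =
     \<lparr>verts = verts (rooted_binary_tree m),
      edges = edges (rooted_binary_tree m) \<union>
        {{Some (w @ [False]), Some (w @ [True])} | w. length w + 1 < m}\<rparr>"

definition k_rooted_sibling_tree :: "nat \<Rightarrow> nat \<Rightarrow> (nat \<times> bool list option) graph" where
  "k_rooted_sibling_tree m k =
     \<lparr>verts = {1..k} \<times> verts (sibling_tree m),
      edges = (\<Union>i\<in>{1..k}. (`) (Pair i) ` edges (sibling_tree m)) \<union>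
        {{(i, None), (i + 1, None)} | i. 1 \<le> i \<and> i + 1 \<le> k}\<rparr>"

text \<open>\<open>subtree_traversal m w\<close> lists the subtree with \<open>m\<close> levels rooted at \<open>w\<close>.\<close>

fun subtree_traversal :: "nat \<Rightarrow> bool list \<Rightarrow> bool list list" where
  "subtree_traversal 0 w = []"
| "subtree_traversal (Suc m) w =
     subtree_traversal m (w @ [False]) @ subtree_traversal m (w @ [True]) @ [w]"

definition sibling_tree_traversal :: "nat \<Rightarrow> bool list option list" where
  "sibling_tree_traversal m = map Some (subtree_traversal m []) @ [None]"

definition traversal_labeling ::
  "nat \<Rightarrow> nat \<Rightarrow> (nat \<times> bool list option \<Rightarrow> nat) \<Rightarrow> bool" where
  "traversal_labeling m k lab \<longleftrightarrow>
     (\<forall>i\<in>{1..k}. \<forall>j<2 ^ m. lab (i, sibling_tree_traversal m ! j) = (i - 1) * 2 ^ m + (j + 1))"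


subsection \<open>Well-definedness\<close>

lemma complete_multipartite_simple:
  assumes "complete_multipartite G Q"
  shows "simple_graph G"
proof -
  have G: "edges G = {{u, v} | u v. u \<in> verts G \<and> v \<in> verts G \<and> \<not> (\<exists>A\<in>Q. u \<in> A \<and> v \<in> A)}"
    and fin: "finite (verts G)" and cover: "\<Union> Q = verts G"
    using assms unfolding complete_multipartite_def partition_on_def by blast+
  have "e \<subseteq> verts G \<and> card e = 2" if "e \<in> edges G" for e
  proof -
    from that obtain u v where e: "e = {u, v}" "u \<in> verts G" "v \<in> verts G"
      "\<not> (\<exists>A\<in>Q. u \<in> A \<and> v \<in> A)"
      unfolding G by blast
    have "u \<noteq> v" using e(2,4) cover by blast
    then show ?thesis using e(1-3) by simp
  qed
  with fin show ?thesis unfolding simple_graph_def by blast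
qed

lemma complete_binary_tree_simple: "simple_graph (complete_binary_tree m)"
proof -
  have "{w :: bool list. length w < m} = (\<Union>l<m. {w. set w \<subseteq> UNIV \<and> length w = l})"
    by auto
  moreover have "finite \<dots>"
    by (intro finite_UN_I finite_lists_length_eq) auto
  ultimately show ?thesis
    by (auto simp: simple_graph_def complete_binary_tree_def)
qed

lemma sibling_tree_simple:
  assumes "m \<ge> 1"
  shows "simple_graph (sibling_tree m)"
  using assms complete_binary_tree_simple[of m]
  unfolding simple_graph_def sibling_tree_def rooted_binary_tree_def
  by (auto simp: card_image complete_binary_tree_def)

lemma k_rooted_sibling_tree_simple:
  assumes "m \<ge> 1"
  shows "simple_graph (k_rooted_sibling_tree m k)"
proof -
  have fin: "finite (verts (sibling_tree m))" and None: "None \<in> verts (sibling_tree m)"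
    and sub: "\<And>e. e \<in> edges (sibling_tree m) \<Longrightarrow> e \<subseteq> verts (sibling_tree m) \<and> card e = 2"
    using sibling_tree_simple[OF assms] unfolding simple_graph_def
    by (blast, simp add: sibling_tree_def rooted_binary_tree_def, blast)
  have "Pair i ` e \<subseteq> {1..k} \<times> verts (sibling_tree m) \<and> card (Pair i ` e) = 2"
    if "i \<in> {1..k}" "e \<in> edges (sibling_tree m)" for i e
    using sub[OF that(2)] that(1) card_image[of "Pair i" e] by (auto simp: inj_on_def)
  with fin None sub show ?thesis
    unfolding simple_graph_def k_rooted_sibling_tree_def by (auto dest: sub)
qed

lemma length_subtree_traversal: "length (subtree_traversal m w) + 1 = 2 ^ m"
proof (induction m arbitrary: w)
  case (Suc m)
  from Suc[of "w @ [False]"] Suc[of "w @ [True]"] show ?case by simp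
qed simp

lemma set_subtree_traversal:
  "set (subtree_traversal m w) = {w @ v | v. length v < m}"
proof (induction m arbitrary: w)
  case (Suc m)
  show ?case (is "?L = ?R")
  proof
    show "?L \<subseteq> ?R" by (auto simp: Suc)
    show "?R \<subseteq> ?L"
    proof
      fix x assume "x \<in> ?R"
      then obtain v where v: "x = w @ v" "length v < Suc m" by blast
      then show "x \<in> ?L"
        by (cases v; cases "hd v") (auto simp: Suc)
    qed
  qed
qed simp

lemma distinct_subtree_traversal: "distinct (subtree_traversal m w)"
  by (induction m arbitrary: w) (auto simp: set_subtree_traversal)

lemma length_sibling_tree_traversal: "length (sibling_tree_traversal m) = 2 ^ m"
  using length_subtree_traversal[of m "[]"] by (simp add: sibling_tree_traversal_def)

lemma distinct_sibling_tree_traversal: "distinct (sibling_tree_traversal m)"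
  by (auto simp: sibling_tree_traversal_def distinct_map distinct_subtree_traversal)

lemma set_sibling_tree_traversal: "set (sibling_tree_traversal m) = verts (sibling_tree m)"
  by (auto simp: sibling_tree_traversal_def sibling_tree_def rooted_binary_tree_def
      complete_binary_tree_def set_subtree_traversal)

end

theory Submission
  imports Defs "HOL-Library.Sublist"
begin

text \<open>
  Every block of the sibling tree \<open>H\<close> is a single edge or a triangle (a parent and its two
  children). Removing the edges of a block splits \<open>H\<close> into one component per corner of the
  block. Count a bridge as two cuts, and a triangle as three cuts, one around each corner:
  moving along an edge then crosses exactly two cuts, in a triangle those around its two ends.
  A shortest path never crosses a cut twice, so twice the distance of two vertices of \<open>H\<close> is the
  number of cuts that separate them (lemmas \<open>card_separators_le_path\<close>, \<open>geodesic_exists\<close> and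
  \<open>cut_representation_sibling_tree\<close>).

  Exchanging the order of summation, twice the wirelength of any embedding \<open>g\<close> is at least the
  sum, over all cuts \<open>S\<close> of \<open>H\<close>, of the number of edges of \<open>G\<close> that leave the preimage of \<open>S\<close>
  under \<open>g\<close>, with equality if all paths are shortest. Since \<open>G\<close> and \<open>H\<close> have equally many
  vertices, \<open>g\<close> is bijective, and the size of the preimage of \<open>S\<close> does not depend on \<open>g\<close>. So it
  suffices that the traversal embedding minimizes each summand separately among all vertex sets
  of the same size.

  In a complete multipartite graph with parts of size \<open>s\<close>, a set \<open>A\<close> is left by
  \<open>|A| (|V| - |A|) - s |A| + (\<Sum>B. |A \<inter> B|\<^sup>2)\<close> edges, where \<open>B\<close> runs over the parts. For fixed
  \<open>|A|\<close> this is least when the numbers \<open>|A \<inter> B|\<close> differ by at most one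
  (\<open>balanced_minimizes_edge_boundary\<close>). The parts being residue classes, any set of
  consecutive labels is balanced in this way (\<open>label_interval_balanced\<close>). Finally, each cut has
  a side on which the labels are consecutive (\<open>label_interval_cut_side\<close>), because the traversal
  lists a subtree in one run, and in that run the descendants of its root directly before the
  root.
\<close>

section \<open>Distances counted by cuts\<close>

definition separators :: "'c set \<Rightarrow> ('c \<Rightarrow> 'b set) \<Rightarrow> 'b \<Rightarrow> 'b \<Rightarrow> 'c set" where
  "separators I C a b = {c \<in> I. (a \<in> C c) \<noteq> (b \<in> C c)}"

lemma separators_commute: "separators I C a b = separators I C b a"
  by (auto simp: separators_def)

lemma finite_separators: "finite I \<Longrightarrow> finite (separators I C a b)"
  by (simp add: separators_def)

lemma card_separators_triangle:
  assumes "finite I"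
  shows "card (separators I C a c) \<le> card (separators I C a b) + card (separators I C b c)"
proof -
  have "separators I C a c \<subseteq> separators I C a b \<union> separators I C b c"
    by (auto simp: separators_def)
  then have "card (separators I C a c) \<le> card (separators I C a b \<union> separators I C b c)"
    using assms by (intro card_mono) (auto simp: finite_separators)
  then show ?thesis
    using card_Un_le order_trans by blast
qed

lemma card_separators_between:
  assumes "finite I" "separators I C a b \<subseteq> separators I C a c"
  shows "card (separators I C a c) = card (separators I C a b) + card (separators I C b c)"
proof -
  have "separators I C a c = separators I C a b \<union> separators I C b c"
    "separators I C a b \<inter> separators I C b c = {}"
    using assms(2) by (auto simp: separators_def)
  then show ?thesis
    using assms(1) by (simp add: card_Un_disjoint finite_separators)
qed

text \<open>This is an embedding of the metric of \<open>H\<close>, scaled by two, into a hypercube: a vertex goes to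
  the set of cuts that contain it. The step in \<open>step_towards\<close>
  may start at either end: in a rooted tree it is easy to climb out of a subtree, but the descent from a
  root depends on the target.\<close>

locale cut_representation =
  fixes H :: "'b graph" and I :: "'c set" and C :: "'c \<Rightarrow> 'b set"
  assumes finite_cuts: "finite I"
    and card_separators_edge: "{u, v} \<in> edges H \<Longrightarrow> card (separators I C u v) = 2"
    and step_towards: "a \<in> verts H \<Longrightarrow> b \<in> verts H \<Longrightarrow> a \<noteq> b \<Longrightarrow>
      \<exists>v\<in>verts H. {a, v} \<in> edges H \<and> separators I C a v \<subseteq> separators I C a b \<or>
        {b, v} \<in> edges H \<and> separators I C b v \<subseteq> separators I C a b"
begin

lemma card_separators_le_path:
  assumes "path H q"
  shows "card (separators I C (hd q) (last q)) \<le> 2 * path_length q"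
proof -
  have "card (separators I C (hd q) (last q)) \<le> 2 * (length q - 1)"
    if "q \<noteq> []" "successively (\<lambda>u v. {u, v} \<in> edges H) q"
    using that
  proof (induction q)
    case (Cons u q)
    show ?case
    proof (cases q)
      case Nil
      then show ?thesis by (simp add: separators_def)
    next
      case (Cons v r)
      with Cons.prems have uv: "{u, v} \<in> edges H"
        and q: "successively (\<lambda>u v. {u, v} \<in> edges H) q" by auto
      have "card (separators I C v (last q)) \<le> 2 * (length q - 1)"
        using Cons.IH q Cons by simp
      moreover have "card (separators I C u (last q))
          \<le> card (separators I C u v) + card (separators I C v (last q))"
        by (rule card_separators_triangle[OF finite_cuts])
      ultimately show ?thesis
        using Cons card_separators_edge[OF uv] by simp
    qed
  qed simp
  then show ?thesis
    using assms by (simp add: path_def path_length_def)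
qed

text \<open>Steps given by \<open>step_towards\<close> reduce the number of separating cuts by two, so a path is built
  by induction on that number. The path must not repeat vertices: the last conjunct says that all
  of its vertices lie in the metric interval between \<open>a\<close> and \<open>b\<close>. The end that is added to a path
  lies outside the interval of the shorter path, since the two cuts just crossed leave that
  interval on one side.\<close>

lemma geodesic_exists:
  assumes "a \<in> verts H" "b \<in> verts H"
  shows "\<exists>q. path H q \<and> hd q = a \<and> last q = b \<and>
    2 * path_length q = card (separators I C a b) \<and>
    (\<forall>v\<in>set q. separators I C a v \<subseteq> separators I C a b)"
  using assms
proof (induction "card (separators I C a b)" arbitrary: a b rule: less_induct)
  case less
  show ?case
  proof (cases "a = b")
    case True
    then show ?thesis
      using less.prems by (intro exI[of _ "[a]"]) (auto simp: path_def path_length_def separators_def)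
  next
    case False
    from step_towards[OF less.prems False] obtain v where v: "v \<in> verts H" and
      "{a, v} \<in> edges H \<and> separators I C a v \<subseteq> separators I C a b \<or>
       {b, v} \<in> edges H \<and> separators I C b v \<subseteq> separators I C a b" by blast
    then show ?thesis
    proof (elim disjE conjE)
      assume av: "{a, v} \<in> edges H" and sub: "separators I C a v \<subseteq> separators I C a b"
      have card: "card (separators I C a b) = 2 + card (separators I C v b)"
        using card_separators_between[OF finite_cuts sub] card_separators_edge[OF av] by simp
      with less.hyps[of v b] v less.prems obtain q where q: "path H q" "hd q = v" "last q = b"
        "2 * path_length q = card (separators I C v b)"
        "\<And>x. x \<in> set q \<Longrightarrow> separators I C v x \<subseteq> separators I C v b" by auto
      have ne: "separators I C a v \<noteq> {}"
        using card_separators_edge[OF av] by auto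
      have "a \<notin> set q"
        using q(5)[of a] sub ne by (auto simp: separators_def)
      then have "path H (a # q)"
        using q(1,2) av less.prems unfolding path_def by (cases q) auto
      moreover have "separators I C a x \<subseteq> separators I C a b" if "x \<in> set (a # q)" for x
        using that q(5)[of x] sub by (auto simp: separators_def)
      moreover have "last (a # q) = b" "2 * path_length (a # q) = card (separators I C a b)"
        using q card by (cases q; simp add: path_def path_length_def)+
      ultimately show ?thesis by (intro exI[of _ "a # q"]) auto
    next
      assume bv: "{b, v} \<in> edges H" and sub: "separators I C b v \<subseteq> separators I C a b"
      have card: "card (separators I C a b) = 2 + card (separators I C a v)"
        using card_separators_between[OF finite_cuts, of C b v a] sub card_separators_edge[OF bv]
        by (simp add: separators_commute)
      with less.hyps[of a v] v less.prems obtain q where q: "path H q" "hd q = a" "last q = v"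
        "2 * path_length q = card (separators I C a v)"
        "\<And>x. x \<in> set q \<Longrightarrow> separators I C a x \<subseteq> separators I C a v" by auto
      have ne: "separators I C b v \<noteq> {}"
        using card_separators_edge[OF bv] by auto
      have "b \<notin> set q"
        using q(5)[of b] sub ne by (auto simp: separators_def)
      then have "path H (q @ [b])"
        using q(1,3) bv less.prems unfolding path_def
        by (auto simp: successively_append_iff insert_commute)
      moreover have "separators I C a x \<subseteq> separators I C a b" if "x \<in> set (q @ [b])" for x
        using that q(5)[of x] sub by (auto simp: separators_def)
      moreover have "hd (q @ [b]) = a" "2 * path_length (q @ [b]) = card (separators I C a b)"
        using q card by (cases q; simp add: path_def path_length_def)+
      ultimately show ?thesis by (intro exI[of _ "q @ [b]"]) auto
    qed
  qed
qed

lemma card_separators_le_path_between: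
  assumes "path_between H a b q"
  shows "card (separators I C a b) \<le> 2 * path_length q"
  using assms card_separators_le_path[of q]
  by (auto simp: path_between_def separators_commute)

lemma shortest_path_le_card_separators:
  assumes "shortest_path_between H a b q" "a \<in> verts H" "b \<in> verts H"
  shows "2 * path_length q \<le> card (separators I C a b)"
proof -
  obtain r where "path H r" "hd r = a" "last r = b" "2 * path_length r = card (separators I C a b)"
    using geodesic_exists[OF assms(2,3)] by blast
  then show ?thesis
    using assms(1) by (fastforce simp: shortest_path_between_def path_between_def)
qed

end


section \<open>Wirelength as a sum of edge boundaries\<close>

definition edge_boundary :: "'a graph \<Rightarrow> 'a set \<Rightarrow> 'a set set" where
  "edge_boundary G A = {e \<in> edges G. e \<inter> A \<noteq> {} \<and> \<not> e \<subseteq> A}"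

lemma finite_edges:
  assumes "simple_graph G"
  shows "finite (edges G)"
  by (rule finite_subset[of _ "Pow (verts G)"]) (use assms in \<open>auto simp: simple_graph_def\<close>)

lemma simple_graph_edgeE:
  assumes "simple_graph G" "e \<in> edges G"
  obtains x y where "e = {x, y}" "x \<in> verts G" "y \<in> verts G"
proof -
  have "card e = 2" "e \<subseteq> verts G" using assms by (auto simp: simple_graph_def)
  then show ?thesis using that unfolding card_2_iff by auto
qed

text \<open>The edges of \<open>G\<close> whose images under \<open>g\<close> have to cross \<open>S\<close>: the share of one cut in the
  wirelength.\<close>

definition pulled_back_boundary ::
  "'a graph \<Rightarrow> ('a \<Rightarrow> 'b) \<Rightarrow> 'b set \<Rightarrow> 'a set set" where
  "pulled_back_boundary G g S = edge_boundary G {x \<in> verts G. g x \<in> S}"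

text \<open>An edge is an unordered pair, so the number of cuts between its two ends is written
  without choosing an order of the ends.\<close>

definition separator_count ::
  "'c set \<Rightarrow> ('c \<Rightarrow> 'b set) \<Rightarrow> ('a \<Rightarrow> 'b) \<Rightarrow> 'a set \<Rightarrow> nat" where
  "separator_count I C g e = card {c \<in> I. \<exists>x\<in>e. \<exists>y\<in>e. g x \<in> C c \<and> g y \<notin> C c}"

lemma separator_count_doubleton:
  "separator_count I C g {x, y} = card (separators I C (g x) (g y))"
  unfolding separator_count_def separators_def by (rule arg_cong[of _ _ card]) auto

text \<open>Double counting of the pairs of an edge of \<open>G\<close> and a cut that separates the images of its
  ends.\<close>

lemma sum_separator_count_eq_sum_boundaries:
  assumes "simple_graph G" "finite I"
  shows "(\<Sum>e\<in>edges G. separator_count I C g e) = (\<Sum>c\<in>I. card (pulled_back_boundary G g (C c)))"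
proof -
  have count: "separator_count I C g e = card {c \<in> I. e \<in> pulled_back_boundary G g (C c)}"
    if e: "e \<in> edges G" for e
  proof -
    obtain x y where xy: "e = {x, y}" "x \<in> verts G" "y \<in> verts G"
      using simple_graph_edgeE[OF assms(1) e] .
    then have "separators I C (g x) (g y) = {c \<in> I. e \<in> pulled_back_boundary G g (C c)}"
      using e by (auto simp: separators_def pulled_back_boundary_def edge_boundary_def)
    then show ?thesis using xy by (simp add: separator_count_doubleton)
  qed
  have "(\<Sum>e\<in>edges G. separator_count I C g e)
      = (\<Sum>e\<in>edges G. card {c \<in> I. e \<in> pulled_back_boundary G g (C c)})"
    by (intro sum.cong) (auto simp: count)
  also have "\<dots> = (\<Sum>c\<in>I. card {e \<in> edges G. e \<in> pulled_back_boundary G g (C c)})"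
    by (rule sum_multicount_gen[symmetric]) (use assms finite_edges in auto)
  also have "\<dots> = (\<Sum>c\<in>I. card (pulled_back_boundary G g (C c)))"
    by (intro sum.cong arg_cong[of _ _ card])
      (auto simp: pulled_back_boundary_def edge_boundary_def)
  finally show ?thesis .
qed

context cut_representation
begin

lemma sum_boundaries_le_wirelength:
  assumes "simple_graph G" "embedding G H g P"
  shows "(\<Sum>c\<in>I. card (pulled_back_boundary G g (C c))) \<le> 2 * embedding_wirelength G P"
proof -
  have "(\<Sum>c\<in>I. card (pulled_back_boundary G g (C c))) = (\<Sum>e\<in>edges G. separator_count I C g e)"
    by (rule sum_separator_count_eq_sum_boundaries[OF assms(1) finite_cuts, symmetric])
  also have "\<dots> \<le> (\<Sum>e\<in>edges G. 2 * path_length (P e))"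
  proof (rule sum_mono)
    fix e assume e: "e \<in> edges G"
    obtain x y where xy: "e = {x, y}" using simple_graph_edgeE[OF assms(1) e] .
    with e assms(2) have "path_between H (g x) (g y) (P e)" by (simp add: embedding_def)
    then show "separator_count I C g e \<le> 2 * path_length (P e)"
      using card_separators_le_path_between xy by (simp add: separator_count_doubleton)
  qed
  finally show ?thesis by (simp add: embedding_wirelength_def sum_distrib_left)
qed

lemma wirelength_le_sum_boundaries:
  assumes "simple_graph G" "f ` verts G \<subseteq> verts H"
    and short: "\<And>x y. {x, y} \<in> edges G \<Longrightarrow> shortest_path_between H (f x) (f y) (P {x, y})"
  shows "2 * embedding_wirelength G P \<le> (\<Sum>c\<in>I. card (pulled_back_boundary G f (C c)))"
proof -
  have "(\<Sum>e\<in>edges G. 2 * path_length (P e)) \<le> (\<Sum>e\<in>edges G. separator_count I C f e)"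
  proof (rule sum_mono)
    fix e assume e: "e \<in> edges G"
    obtain x y where xy: "e = {x, y}" "x \<in> verts G" "y \<in> verts G"
      using simple_graph_edgeE[OF assms(1) e] .
    then show "2 * path_length (P e) \<le> separator_count I C f e"
      using shortest_path_le_card_separators[OF short] assms(2) e
      by (auto simp: separator_count_doubleton)
  qed
  also have "\<dots> = (\<Sum>c\<in>I. card (pulled_back_boundary G f (C c)))"
    by (rule sum_separator_count_eq_sum_boundaries[OF assms(1) finite_cuts])
  finally show ?thesis by (simp add: embedding_wirelength_def sum_distrib_left)
qed

end

lemma card_vimage_bij_betw:
  assumes "bij_betw g V W"
  shows "card {x \<in> V. g x \<in> S} = card (W \<inter> S)"
proof -
  have "bij_betw g {x \<in> V. g x \<in> S} (W \<inter> S)"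
    using assms by (auto simp: bij_betw_def inj_on_def)
  then show ?thesis by (rule bij_betw_same_card)
qed


section \<open>Edge boundaries in complete multipartite graphs\<close>

text \<open>Among the pairs of a vertex inside \<open>A\<close> and one outside, exactly those within a common part are
  not edges.\<close>

lemma card_edge_boundary_complete_multipartite:
  assumes G: "complete_multipartite G Q" and A: "A \<subseteq> verts G"
  shows "card (edge_boundary G A) + (\<Sum>B\<in>Q. card (A \<inter> B) * card (B - A))
    = card A * card (verts G - A)"
proof -
  have fin: "finite (verts G)" and part: "partition_on (verts G) Q"
    and E: "edges G = {{u, v} | u v. u \<in> verts G \<and> v \<in> verts G \<and> \<not> (\<exists>B\<in>Q. u \<in> B \<and> v \<in> B)}"
    using G by (auto simp: complete_multipartite_def)
  have Q: "finite Q" "\<Union> Q = verts G" "disjoint Q"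
    using part fin by (auto simp: partition_on_def finite_elements)
  have finB: "finite B" if "B \<in> Q" for B
    using that Q(2) fin finite_subset[of B "verts G"] by auto
  have finA: "finite A" using A fin finite_subset by blast
  define X where "X = {(u, v). u \<in> A \<and> v \<in> verts G - A \<and> \<not> (\<exists>B\<in>Q. u \<in> B \<and> v \<in> B)}"
  define Y where "Y = (\<Union>B\<in>Q. (A \<inter> B) \<times> (B - A))"
  have XY: "A \<times> (verts G - A) = X \<union> Y" "X \<inter> Y = {}"
    using Q(2) by (auto simp: X_def Y_def)
  have "finite (X \<union> Y)" using XY(1) finA fin by (metis finite_Diff finite_cartesian_product)
  then have "card A * card (verts G - A) = card X + card Y"
    using XY card_Un_disjoint[of X Y] by (metis card_cartesian_product finite_Un)
  moreover have "card Y = (\<Sum>B\<in>Q. card (A \<inter> B) * card (B - A))"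
    unfolding Y_def using Q finB
    by (subst card_UN_disjoint) (auto simp: card_cartesian_product disjoint_def)
  moreover have "bij_betw (\<lambda>(u, v). {u, v}) X (edge_boundary G A)"
    unfolding bij_betw_def
  proof
    show "inj_on (\<lambda>(u, v). {u, v}) X"
      by (auto simp: inj_on_def X_def doubleton_eq_iff)
    show "(\<lambda>(u, v). {u, v}) ` X = edge_boundary G A"
    proof
      show "(\<lambda>(u, v). {u, v}) ` X \<subseteq> edge_boundary G A"
        using A by (auto simp: X_def edge_boundary_def E)
      show "edge_boundary G A \<subseteq> (\<lambda>(u, v). {u, v}) ` X"
      proof
        fix e assume "e \<in> edge_boundary G A"
        then obtain u v where e: "e = {u, v}" "u \<in> verts G" "v \<in> verts G"
          "\<not> (\<exists>B\<in>Q. u \<in> B \<and> v \<in> B)" "e \<inter> A \<noteq> {}" "\<not> e \<subseteq> A"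
          unfolding edge_boundary_def E by blast
        then have "(u, v) \<in> X \<or> (v, u) \<in> X" by (auto simp: X_def)
        then show "e \<in> (\<lambda>(u, v). {u, v}) ` X"
          using e(1) by (auto simp: insert_commute image_iff split: prod.splits)
      qed
    qed
  qed
  ultimately show ?thesis by (simp add: bij_betw_same_card)
qed

text \<open>Integers satisfy \<open>(x - q) (x - (q + 1)) \<ge> 0\<close>, with equality at \<open>q\<close> and \<open>q + 1\<close>. This bounds
  a square from below by a linear function, and the sum of a linear function depends only on the
  sum of the arguments.\<close>

lemma sum_squares_balanced_le:
  fixes a b :: "'i \<Rightarrow> int"
  assumes "sum a S = sum b S" "\<And>i. i \<in> S \<Longrightarrow> a i = q \<or> a i = q + 1"
  shows "(\<Sum>i\<in>S. a i * a i) \<le> (\<Sum>i\<in>S. b i * b i)"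
proof -
  have "(2 * q + 1) * x - q * (q + 1) \<le> x * x" for x :: int
  proof -
    have "0 \<le> (x - q) * (x - (q + 1))"
      by (cases "x \<le> q") (auto intro: mult_nonpos_nonpos mult_nonneg_nonneg)
    then show ?thesis by (simp add: algebra_simps)
  qed
  then have "(\<Sum>i\<in>S. (2 * q + 1) * b i - q * (q + 1)) \<le> (\<Sum>i\<in>S. b i * b i)"
    by (intro sum_mono) auto
  moreover have "(\<Sum>i\<in>S. (2 * q + 1) * a i - q * (q + 1)) = (\<Sum>i\<in>S. a i * a i)"
    by (intro sum.cong) (use assms(2) in \<open>force simp: algebra_simps\<close>)+
  ultimately show ?thesis
    using assms(1) by (simp add: sum_subtractf flip: sum_distrib_left)
qed

lemma balanced_minimizes_edge_boundary:
  assumes G: "complete_multipartite G Q" and s: "\<forall>B\<in>Q. card B = s"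
    and A: "A \<subseteq> verts G" and A': "A' \<subseteq> verts G" and card: "card A = card A'"
    and balanced: "\<forall>B\<in>Q. card (A \<inter> B) = q \<or> card (A \<inter> B) = q + 1"
  shows "card (edge_boundary G A) \<le> card (edge_boundary G A')"
proof -
  have fin: "finite (verts G)" and part: "partition_on (verts G) Q"
    using G by (auto simp: complete_multipartite_def)
  have Q: "finite Q" "\<Union> Q = verts G" "disjoint Q"
    using part fin by (auto simp: partition_on_def finite_elements)
  have finB: "finite B" if "B \<in> Q" for B
    using that Q(2) fin finite_subset[of B "verts G"] by auto
  have sum_parts: "(\<Sum>B\<in>Q. int (card (X \<inter> B))) = int (card X)" if "X \<subseteq> verts G" for X
  proof -
    have "X = (\<Union>B\<in>Q. X \<inter> B)" using that Q(2) by auto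
    then have "card X = card (\<Union>B\<in>Q. X \<inter> B)" by (rule arg_cong)
    also have "\<dots> = (\<Sum>B\<in>Q. card (X \<inter> B))"
      by (rule card_UN_disjoint) (use Q finB in \<open>auto simp: disjoint_def\<close>)
    finally show ?thesis by simp
  qed
  have boundary: "int (card (edge_boundary G X)) =
      int (card X) * int (card (verts G - X)) - int s * int (card X)
      + (\<Sum>B\<in>Q. int (card (X \<inter> B)) * int (card (X \<inter> B)))" if X: "X \<subseteq> verts G" for X
  proof -
    have "int (card (B - X)) = int s - int (card (X \<inter> B))" if "B \<in> Q" for B
    proof -
      have "card (B - X) + card (X \<inter> B) = card B"
        using finB[OF that] by (metis card_Diff_subset_Int card_mono finite_Int inf_commute
          inf_le1 le_add_diff_inverse2)
      then show ?thesis using s that by auto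
    qed
    then have "(\<Sum>B\<in>Q. int (card (X \<inter> B)) * int (card (B - X)))
        = (\<Sum>B\<in>Q. int s * int (card (X \<inter> B)) - int (card (X \<inter> B)) * int (card (X \<inter> B)))"
      by (intro sum.cong refl) (simp add: right_diff_distrib mult.commute)
    also have "\<dots> = int s * int (card X) - (\<Sum>B\<in>Q. int (card (X \<inter> B)) * int (card (X \<inter> B)))"
      by (simp add: sum_subtractf sum_parts[OF X] flip: sum_distrib_left)
    finally show ?thesis
      using arg_cong[OF card_edge_boundary_complete_multipartite[OF G X], of int] by simp
  qed
  have "card (verts G - A) = card (verts G - A')"
    using A A' card fin by (metis card_Diff_subset finite_subset)
  moreover have "(\<Sum>B\<in>Q. int (card (A \<inter> B)) * int (card (A \<inter> B)))
      \<le> (\<Sum>B\<in>Q. int (card (A' \<inter> B)) * int (card (A' \<inter> B)))"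
    by (rule sum_squares_balanced_le[where q = "int q"])
      (use sum_parts[OF A] sum_parts[OF A'] card balanced in force)+
  ultimately have "int (card (edge_boundary G A)) \<le> int (card (edge_boundary G A'))"
    using card by (simp add: boundary[OF A] boundary[OF A'])
  then show ?thesis by simp
qed

lemma inj_on_mod_window:
  fixes M l d :: nat
  assumes "d \<le> M"
  shows "inj_on (\<lambda>j. j mod M) {l..<l + d}"
proof (rule linorder_inj_onI')
  fix i j assume *: "i \<in> {l..<l + d}" "j \<in> {l..<l + d}" "i < j"
  show "i mod M \<noteq> j mod M"
  proof
    assume "i mod M = j mod M"
    then have "M dvd j - i" using * by (metis mod_eq_dvd_iff_nat less_imp_le)
    then show False using * assms by (auto dest!: dvd_imp_le)
  qed
qed

text \<open>Each window of \<open>M\<close> consecutive numbers contains every residue once. Cutting off such windows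
  leaves fewer than \<open>M\<close> numbers, among which a residue occurs at most once.\<close>

lemma card_residue_in_interval:
  fixes M l d r :: nat
  assumes "r < M"
  shows "card {j \<in> {l..<l + d}. j mod M = r} = d div M \<or>
    card {j \<in> {l..<l + d}. j mod M = r} = d div M + 1"
proof (induction d arbitrary: l rule: less_induct)
  case (less d)
  show ?case
  proof (cases "d < M")
    case True
    have "card {j \<in> {l..<l + d}. j mod M = r} \<le> card {r}"
      by (rule card_inj_on_le[where f = "\<lambda>j. j mod M"])
        (use inj_on_mod_window[of d M l] True in \<open>auto intro: inj_on_subset\<close>)
    moreover have "d div M = 0" "card {r} = 1" using True by simp_all
    ultimately show ?thesis by linarith
  next
    case False
    let ?W = "\<lambda>l d. {j \<in> {l..<l + d}. j mod M = r}"
    have inj: "inj_on (\<lambda>j. j mod M) {l..<l + M}" by (rule inj_on_mod_window) simp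
    have "(\<lambda>j. j mod M) ` {l..<l + M} = {..<M}"
      by (rule card_subset_eq) (use assms card_image[OF inj] in auto)
    then have "r \<in> (\<lambda>j. j mod M) ` {l..<l + M}" using assms by simp
    then obtain j where j: "j \<in> {l..<l + M}" "j mod M = r" by auto
    then have "?W l M = {j}" using inj by (auto simp: inj_on_def)
    then have "card (?W l M) = 1" by simp
    moreover have "?W l d = ?W l M \<union> ?W (l + M) (d - M)" "?W l M \<inter> ?W (l + M) (d - M) = {}"
      using False by auto
    then have "card (?W l d) = card (?W l M) + card (?W (l + M) (d - M))"
      by (simp add: card_Un_disjoint del: atLeastLessThan_iff)
    moreover have "d div M = (d - M) div M + 1" using False assms by (simp add: le_div_geq)
    ultimately show ?thesis using less.IH[of "d - M" "l + M"] False assms by auto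
  qed
qed

lemma label_interval_balanced:
  fixes lab :: "'a \<Rightarrow> nat"
  assumes lab: "bij_betw lab V {1..N}" and M: "M > 0"
    and A: "A = {x \<in> V. l \<le> lab x \<and> lab x < u}"
  obtains q where
    "\<forall>r<M. card (A \<inter> {x \<in> V. lab x mod M = r}) \<in> {q, q + 1}"
proof -
  \<comment> \<open>Clipping to the labels that occur makes the count exact for arbitrary \<open>l\<close> and \<open>u\<close>.\<close>
  define l' where "l' = max l 1"
  define d where "d = min u (N + 1) - l'"
  have "card (A \<inter> {x \<in> V. lab x mod M = r}) = card {j \<in> {l'..<l' + d}. j mod M = r}" for r
  proof -
    have "A \<inter> {x \<in> V. lab x mod M = r} = {x \<in> V. lab x \<in> {j. l \<le> j \<and> j < u \<and> j mod M = r}}"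
      unfolding A by auto
    moreover have "{1..N} \<inter> {j. l \<le> j \<and> j < u \<and> j mod M = r} = {j \<in> {l'..<l' + d}. j mod M = r}"
      by (auto simp: l'_def d_def)
    ultimately show ?thesis
      using card_vimage_bij_betw[OF lab, of "{j. l \<le> j \<and> j < u \<and> j mod M = r}"] by simp
  qed
  then show ?thesis
    using that[of "d div M"] card_residue_in_interval[of _ M l' d] by auto
qed


section \<open>The cuts of the sibling tree\<close>

text \<open>Cuts are names rather than sets, since the same set may have to be counted twice. For a word
  \<open>w\<close>, \<open>Subtree i w\<close> is the cut around the corner \<open>w\<close> of the triangle (or bridge) above \<open>w\<close>, and
  \<open>Below i (Some w)\<close> is the cut around the corner \<open>w\<close> of the triangle below \<open>w\<close>, given by the side
  away from \<open>w\<close>. The bridge at the root of a copy has the two equal cuts \<open>Below i None\<close> and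
  \<open>Subtree i []\<close>. The bridge from the \<open>i\<close>-th root to the next has the two cuts \<open>Front b i\<close>, with
  \<open>b\<close> only telling them apart. The cuts below leaves and \<open>Front b k\<close> separate nothing; they make
  the index set uniform.\<close>

datatype sibling_cut =
    Subtree nat "bool list"
  | Below nat "bool list option"
  | Front bool nat

fun cut_side :: "sibling_cut \<Rightarrow> (nat \<times> bool list option) set" where
  "cut_side (Subtree i w) = {i} \<times> Some ` {v. prefix w v}"
| "cut_side (Below i None) = {i} \<times> range Some"
| "cut_side (Below i (Some w)) = {i} \<times> Some ` {v. strict_prefix w v}"
| "cut_side (Front b i) = {..i} \<times> UNIV"

definition sibling_cuts :: "nat \<Rightarrow> nat \<Rightarrow> sibling_cut set" where
  "sibling_cuts m k =
     case_prod Subtree ` ({1..k} \<times> {w. length w < m}) \<union>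
     case_prod Below ` ({1..k} \<times> verts (sibling_tree m)) \<union>
     case_prod Front ` (UNIV \<times> {1..k})"

lemma verts_sibling_tree: "verts (sibling_tree m) = insert None (Some ` {w. length w < m})"
  by (simp add: sibling_tree_def rooted_binary_tree_def complete_binary_tree_def)

lemma verts_k_rooted_sibling_tree:
  "verts (k_rooted_sibling_tree m k) = {1..k} \<times> insert None (Some ` {w. length w < m})"
  by (simp add: k_rooted_sibling_tree_def verts_sibling_tree)

lemma finite_sibling_cuts: "finite (sibling_cuts m k)"
proof -
  have "finite {w :: bool list. length w < m}"
    using complete_binary_tree_simple[of m]
    by (simp add: simple_graph_def complete_binary_tree_def)
  then show ?thesis by (simp add: sibling_cuts_def verts_sibling_tree)
qed

lemma sibling_cuts_iff [simp]:
  "Subtree i w \<in> sibling_cuts m k \<longleftrightarrow> i \<in> {1..k} \<and> length w < m"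
  "Below i y \<in> sibling_cuts m k \<longleftrightarrow> i \<in> {1..k} \<and> y \<in> verts (sibling_tree m)"
  "Front b i \<in> sibling_cuts m k \<longleftrightarrow> i \<in> {1..k}"
  by (auto simp: sibling_cuts_def)

abbreviation tree_separators ::
  "nat \<Rightarrow> nat \<Rightarrow> nat \<times> bool list option \<Rightarrow> nat \<times> bool list option \<Rightarrow> sibling_cut set" where
  "tree_separators m k \<equiv> separators (sibling_cuts m k) cut_side"

lemma cut_side_iff:
  "(j, x) \<in> cut_side c \<longleftrightarrow> (case c of
      Subtree i w \<Rightarrow> j = i \<and> (\<exists>v. x = Some v \<and> prefix w v)
    | Below i y \<Rightarrow> j = i \<and> (\<exists>v. x = Some v \<and> (case y of None \<Rightarrow> True | Some w \<Rightarrow> strict_prefix w v))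
    | Front b i \<Rightarrow> j \<le> i)"
  by (cases c rule: cut_side.cases) auto

lemma separators_root_edge:
  assumes "i \<in> {1..k}" "m \<ge> 1"
  shows "tree_separators m k (i, None) (i, Some []) = {Below i None, Subtree i []}" (is "?L = ?R")
proof (rule set_eqI)
  fix c
  show "c \<in> ?L \<longleftrightarrow> c \<in> ?R"
    using assms
    by (cases c rule: cut_side.cases)
      (auto simp: separators_def cut_side_iff verts_sibling_tree strict_prefix_def prefix_snoc
        dest: prefix_length_le)
qed

lemma separators_parent_edge:
  assumes "i \<in> {1..k}" "length w + 1 < m"
  shows "tree_separators m k (i, Some w) (i, Some (w @ [b])) =
    {Below i (Some w), Subtree i (w @ [b])}" (is "?L = ?R")
proof (rule set_eqI)
  fix c
  show "c \<in> ?L \<longleftrightarrow> c \<in> ?R"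
    using assms
    by (cases c rule: cut_side.cases)
      (auto simp: separators_def cut_side_iff verts_sibling_tree strict_prefix_def prefix_snoc
        dest: prefix_length_le)
qed

lemma separators_sibling_edge:
  assumes "i \<in> {1..k}" "length w + 1 < m"
  shows "tree_separators m k (i, Some (w @ [b])) (i, Some (w @ [\<not> b])) =
    {Subtree i (w @ [b]), Subtree i (w @ [\<not> b])}" (is "?L = ?R")
proof (rule set_eqI)
  fix c
  show "c \<in> ?L \<longleftrightarrow> c \<in> ?R"
    using assms
    by (cases c rule: cut_side.cases)
      (auto simp: separators_def cut_side_iff verts_sibling_tree strict_prefix_def prefix_snoc
        dest: prefix_length_le)
qed

lemma separators_path_edge:
  assumes "1 \<le> i" "i + 1 \<le> k"
  shows "tree_separators m k (i, None) (i + 1, None) = {Front False i, Front True i}" (is "?L = ?R")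
proof (rule set_eqI)
  fix c
  show "c \<in> ?L \<longleftrightarrow> c \<in> ?R"
    using assms
    by (cases c rule: cut_side.cases)
      (auto simp: separators_def cut_side_iff verts_sibling_tree strict_prefix_def prefix_snoc
        dest: prefix_length_le)
qed

lemma edges_sibling_tree:
  "edges (sibling_tree m) = insert {None, Some []}
     ({{Some w, Some (w @ [b])} | w b. length w + 1 < m} \<union>
      {{Some (w @ [False]), Some (w @ [True])} | w. length w + 1 < m})"
proof -
  have "(`) Some ` {{w, w @ [b]} | (w :: bool list) b. length w + 1 < m} =
      {{Some w, Some (w @ [b])} | w b. length w + 1 < m}"
  proof (intro equalityI subsetI)
    fix e assume "e \<in> {{Some w, Some (w @ [b])} | w b. length w + 1 < m}"
    then obtain w b where "e = Some ` {w, w @ [b]}" "length w + 1 < m" by auto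
    then show "e \<in> (`) Some ` {{w, w @ [b]} | w b. length w + 1 < m}" by blast
  qed auto
  then show ?thesis
    unfolding sibling_tree_def rooted_binary_tree_def complete_binary_tree_def
    by (simp only: graph.simps Un_insert_left)
qed

lemma k_rooted_edge_cases [consumes 1, case_names root parent sibling path]:
  assumes "e \<in> edges (k_rooted_sibling_tree m k)"
  obtains i where "e = {(i, None), (i, Some [])}" "i \<in> {1..k}"
  | i w b where "e = {(i, Some w), (i, Some (w @ [b]))}" "i \<in> {1..k}" "length w + 1 < m"
  | i w where "e = {(i, Some (w @ [False])), (i, Some (w @ [True]))}" "i \<in> {1..k}"
      "length w + 1 < m"
  | i where "e = {(i, None), (i + 1, None)}" "1 \<le> i" "i + 1 \<le> k"
proof -
  consider i e' where "e = Pair i ` e'" "i \<in> {1..k}" "e' \<in> edges (sibling_tree m)"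
    | i where "e = {(i, None), (i + 1, None)}" "1 \<le> i" "i + 1 \<le> k"
    using assms unfolding k_rooted_sibling_tree_def by auto
  then show ?thesis
  proof cases
    case 1
    from 1(3) consider "e' = {None, Some []}"
      | w b where "e' = {Some w, Some (w @ [b])}" "length w + 1 < m"
      | w where "e' = {Some (w @ [False]), Some (w @ [True])}" "length w + 1 < m"
      unfolding edges_sibling_tree by blast
    then show ?thesis by cases (use 1(1,2) that in auto)
  qed (use that in blast)
qed

lemma k_rooted_edge_of_sibling_tree_edge:
  assumes "i \<in> {1..k}" "{x, y} \<in> edges (sibling_tree m)"
  shows "{(i, x), (i, y)} \<in> edges (k_rooted_sibling_tree m k)"
proof -
  have "Pair i ` {x, y} \<in> (\<Union>i\<in>{1..k}. (`) (Pair i) ` edges (sibling_tree m))"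
    using assms by blast
  then show ?thesis by (simp add: k_rooted_sibling_tree_def)
qed

lemma k_rooted_edgeI:
  shows "i \<in> {1..k} \<Longrightarrow> {(i, None), (i, Some [])} \<in> edges (k_rooted_sibling_tree m k)"
    and "i \<in> {1..k} \<Longrightarrow> length w + 1 < m \<Longrightarrow>
      {(i, Some w), (i, Some (w @ [b]))} \<in> edges (k_rooted_sibling_tree m k)"
    and "i \<in> {1..k} \<Longrightarrow> length w + 1 < m \<Longrightarrow>
      {(i, Some (w @ [b])), (i, Some (w @ [\<not> b]))} \<in> edges (k_rooted_sibling_tree m k)"
    and "1 \<le> i \<Longrightarrow> i + 1 \<le> k \<Longrightarrow>
      {(i, None), (i + 1, None)} \<in> edges (k_rooted_sibling_tree m k)"
proof -
  show "{(i, Some (w @ [b])), (i, Some (w @ [\<not> b]))} \<in> edges (k_rooted_sibling_tree m k)"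
    if "i \<in> {1..k}" "length w + 1 < m"
  proof (rule k_rooted_edge_of_sibling_tree_edge[OF that(1)])
    have "{Some (w @ [b]), Some (w @ [\<not> b])} = {Some (w @ [False]), Some (w @ [True])}"
      by (cases b) auto
    then show "{Some (w @ [b]), Some (w @ [\<not> b])} \<in> edges (sibling_tree m)"
      using that(2) unfolding edges_sibling_tree by blast
  qed
  show "{(i, None), (i, Some [])} \<in> edges (k_rooted_sibling_tree m k)" if "i \<in> {1..k}"
    by (rule k_rooted_edge_of_sibling_tree_edge[OF that]) (simp add: edges_sibling_tree)
  show "{(i, Some w), (i, Some (w @ [b]))} \<in> edges (k_rooted_sibling_tree m k)"
    if "i \<in> {1..k}" "length w + 1 < m"
  proof (rule k_rooted_edge_of_sibling_tree_edge[OF that(1)])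
    show "{Some w, Some (w @ [b])} \<in> edges (sibling_tree m)"
      using that(2) unfolding edges_sibling_tree by blast
  qed
  show "{(i, None), (i + 1, None)} \<in> edges (k_rooted_sibling_tree m k)" if "1 \<le> i" "i + 1 \<le> k"
    unfolding k_rooted_sibling_tree_def using that by auto
qed

text \<open>From \<open>w\<close> to a vertex outside its subtree, the step goes to the sibling if the target lies in
  the sibling's subtree, and to the parent otherwise.\<close>

lemma step_out_of_subtree:
  assumes m: "m \<ge> 1" and a: "i \<in> {1..k}" "length w < m" and b: "b \<notin> cut_side (Subtree i w)"
  shows "\<exists>v\<in>verts (k_rooted_sibling_tree m k). {(i, Some w), v} \<in> edges (k_rooted_sibling_tree m k) \<and>
    tree_separators m k (i, Some w) v \<subseteq> tree_separators m k (i, Some w) b"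
proof (cases w rule: rev_cases)
  case Nil
  have "(i, None) \<in> verts (k_rooted_sibling_tree m k)"
    using a by (simp add: verts_k_rooted_sibling_tree)
  moreover have "{(i, Some []), (i, None)} \<in> edges (k_rooted_sibling_tree m k)"
    using k_rooted_edgeI(1)[OF a(1), of m] by (simp add: insert_commute)
  moreover have "tree_separators m k (i, Some []) (i, None) = {Below i None, Subtree i []}"
    using separators_root_edge[OF a(1) m] by (metis separators_commute)
  moreover have "{Below i None, Subtree i []} \<subseteq> tree_separators m k (i, Some []) b"
    using a m b Nil
    by (cases b; cases "snd b") (auto simp: separators_def cut_side_iff verts_sibling_tree)
  ultimately show ?thesis using Nil by metis
next
  case (snoc u c)
  show ?thesis
  proof (cases "b \<in> cut_side (Subtree i (u @ [\<not> c]))")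
    case True
    have "(i, Some (u @ [\<not> c])) \<in> verts (k_rooted_sibling_tree m k)"
      using a snoc by (simp add: verts_k_rooted_sibling_tree)
    moreover have "{(i, Some w), (i, Some (u @ [\<not> c]))} \<in> edges (k_rooted_sibling_tree m k)"
      using k_rooted_edgeI(3)[OF a(1), of u m c] a snoc by simp
    moreover have "tree_separators m k (i, Some w) (i, Some (u @ [\<not> c]))
        = {Subtree i w, Subtree i (u @ [\<not> c])}"
      using separators_sibling_edge[OF a(1), of u m c] a snoc by simp
    moreover have "{Subtree i w, Subtree i (u @ [\<not> c])} \<subseteq> tree_separators m k (i, Some w) b"
      using a b True snoc by (cases b) (auto simp: separators_def cut_side_iff)
    ultimately show ?thesis by metis
  next
    case False
    have "(i, Some u) \<in> verts (k_rooted_sibling_tree m k)"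
      using a snoc by (simp add: verts_k_rooted_sibling_tree)
    moreover have "{(i, Some w), (i, Some u)} \<in> edges (k_rooted_sibling_tree m k)"
      using k_rooted_edgeI(2)[OF a(1), of u m c] a snoc by (simp add: insert_commute)
    moreover have "tree_separators m k (i, Some w) (i, Some u) = {Below i (Some u), Subtree i w}"
      using separators_parent_edge[OF a(1), of u m c] a snoc separators_commute by fastforce
    moreover have "b \<notin> cut_side (Below i (Some u))"
    proof
      assume "b \<in> cut_side (Below i (Some u))"
      then obtain v where v: "b = (i, Some v)" "strict_prefix u v" by auto
      then obtain z where "v = u @ z" "z \<noteq> []" by (auto simp: strict_prefix_def prefix_def)
      then obtain d z' where "v = u @ d # z'" by (cases z) auto
      then show False
        using v(1) b False snoc by (cases "d = c") (auto simp: prefix_def)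
    qed
    then have "{Below i (Some u), Subtree i w} \<subseteq> tree_separators m k (i, Some w) b"
      using a b snoc
      by (cases b) (auto simp: separators_def cut_side_iff verts_sibling_tree strict_prefix_def)
    ultimately show ?thesis by metis
  qed
qed

lemma step_along_roots:
  assumes "i \<in> {1..k}" "j \<in> {1..k}" "i < j"
  shows "\<exists>v\<in>verts (k_rooted_sibling_tree m k). {(i, None), v} \<in> edges (k_rooted_sibling_tree m k) \<and>
    tree_separators m k (i, None) v \<subseteq> tree_separators m k (i, None) (j, None)"
proof (intro bexI conjI)
  show "{(i, None), (i + 1, None)} \<in> edges (k_rooted_sibling_tree m k)"
    using assms by (intro k_rooted_edgeI) auto
  have "tree_separators m k (i, None) (i + 1, None) = {Front False i, Front True i}"
    using assms by (intro separators_path_edge) auto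
  then show "tree_separators m k (i, None) (i + 1, None)
      \<subseteq> tree_separators m k (i, None) (j, None)"
    using assms by (auto simp: separators_def)
  show "(i + 1, None) \<in> verts (k_rooted_sibling_tree m k)"
    using assms by (auto simp: verts_k_rooted_sibling_tree)
qed

text \<open>If neither of two vertices can step out of its own subtree away from the other, then both are
  roots of copies: two words that are prefixes of each other are equal.\<close>

lemma cut_representation_sibling_tree:
  assumes m: "m \<ge> 1"
  shows "cut_representation (k_rooted_sibling_tree m k) (sibling_cuts m k) cut_side"
proof
  show "finite (sibling_cuts m k)" by (rule finite_sibling_cuts)
next
  fix u v assume uv: "{u, v} \<in> edges (k_rooted_sibling_tree m k)"
  from uv obtain x y where xy: "{u, v} = {x, y}" "card (tree_separators m k x y) = 2"
  proof (cases rule: k_rooted_edge_cases)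
    case (root i)
    show ?thesis
      by (rule that[OF root(1)]) (simp add: separators_root_edge[OF root(2) m])
  next
    case (parent i w b)
    show ?thesis
      by (rule that[OF parent(1)]) (simp add: separators_parent_edge[OF parent(2,3)])
  next
    case (sibling i w)
    show ?thesis
      by (rule that[OF sibling(1)])
        (use separators_sibling_edge[OF sibling(2,3), of False] in simp)
  next
    case (path i)
    show ?thesis
      by (rule that[OF path(1)]) (use separators_path_edge[OF path(2,3), of m] in simp)
  qed
  from xy(1) consider "u = x" "v = y" | "u = y" "v = x" by (auto simp: doubleton_eq_iff)
  then show "card (tree_separators m k u v) = 2"
    by cases (use xy(2) in \<open>simp_all add: separators_commute[of _ _ y x]\<close>)
next
  fix a b assume ab: "a \<in> verts (k_rooted_sibling_tree m k)" "b \<in> verts (k_rooted_sibling_tree m k)" "a \<noteq> b"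
  obtain i x j y where a_eq: "a = (i, x)" and b_eq: "b = (j, y)" by (cases a; cases b) auto
  have ij: "i \<in> {1..k}" "j \<in> {1..k}"
    and x: "\<And>w. x = Some w \<Longrightarrow> length w < m" and y: "\<And>w. y = Some w \<Longrightarrow> length w < m"
    using ab a_eq b_eq by (auto simp: verts_k_rooted_sibling_tree)
  consider (out_of_a) w where "x = Some w" "b \<notin> cut_side (Subtree i w)"
    | (out_of_b) w where "y = Some w" "a \<notin> cut_side (Subtree j w)"
    | (roots) "x = None" "y = None" "i \<noteq> j"
  proof (cases x; cases y)
    fix w w' assume xy: "x = Some w" "y = Some w'"
    then have "\<not> (i = j \<and> prefix w w' \<and> prefix w' w)"
      using ab(3) a_eq b_eq prefix_order.antisym[of w w'] by auto
    then show thesis using that xy a_eq b_eq by auto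
  qed (use that ab(3) a_eq b_eq in auto)
  then show "\<exists>v\<in>verts (k_rooted_sibling_tree m k).
      {a, v} \<in> edges (k_rooted_sibling_tree m k) \<and> tree_separators m k a v \<subseteq> tree_separators m k a b \<or>
      {b, v} \<in> edges (k_rooted_sibling_tree m k) \<and> tree_separators m k b v \<subseteq> tree_separators m k a b"
  proof cases
    case (out_of_a w)
    then show ?thesis using step_out_of_subtree[OF m ij(1) x[OF out_of_a(1)]] out_of_a a_eq by blast
  next
    case (out_of_b w)
    then show ?thesis using step_out_of_subtree[OF m ij(2) y[OF out_of_b(1)]] out_of_b b_eq
        separators_commute[of _ _ a "(j, y)"] by metis
  next
    case roots
    then consider "i < j" | "j < i" by linarith
    then show ?thesis
    proof cases
      case 1
      then show ?thesis using step_along_roots[OF ij 1] a_eq b_eq roots by blast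
    next
      case 2
      then show ?thesis using step_along_roots[OF ij(2,1) 2] a_eq b_eq roots
          separators_commute[of _ _ a b] by metis
    qed
  qed
qed


section \<open>Cuts are intervals of labels\<close>

lemma subtree_traversal_infix:
  "\<exists>pre post. subtree_traversal (length v + j) w = pre @ subtree_traversal j (w @ v) @ post"
proof (induction v arbitrary: w)
  case Nil
  show ?case by (intro exI[of _ "[]"]) simp
next
  case (Cons b v)
  from Cons[of "w @ [b]"] obtain pre post where
    *: "subtree_traversal (length v + j) (w @ [b]) = pre @ subtree_traversal j (w @ b # v) @ post"
    by auto
  show ?case
  proof (cases b)
    case True
    then show ?thesis using *
      by (intro exI[of _ "subtree_traversal (length v + j) (w @ [False]) @ pre"] exI[of _ "post @ [w]"])
        simp
  next
    case False
    then show ?thesis using *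
      by (intro exI[of _ pre] exI[of _ "post @ subtree_traversal (length v + j) (w @ [True]) @ [w]"])
        simp
  qed
qed

lemma nth_mem_infix_iff:
  assumes "distinct (pre @ mid @ post)" "j < length (pre @ mid @ post)"
  shows "(pre @ mid @ post) ! j \<in> set mid \<longleftrightarrow> length pre \<le> j \<and> j < length pre + length mid"
  using assms by (auto simp: nth_append disjoint_iff)

text \<open>The copies occupy disjoint blocks of \<open>M = 2 ^ m\<close> labels, so a run of positions within one
  copy is an interval of labels globally.\<close>

lemma mult_add_block_iff:
  fixes i i' j l u M :: nat
  assumes "j < M" "u \<le> M" "1 \<le> i" "1 \<le> i'"
  shows "i' = i \<and> l \<le> j \<and> j < u \<longleftrightarrow>
    (i - 1) * M + (l + 1) \<le> (i' - 1) * M + (j + 1) \<and> (i' - 1) * M + (j + 1) < (i - 1) * M + (u + 1)"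
  (is "?L \<longleftrightarrow> ?R")
proof
  assume R: ?R
  obtain a where a: "i = Suc a" using assms by (cases i) auto
  have "((i' - 1) * M + j) div M = i' - 1" using assms by simp
  moreover have "((i' - 1) * M + j) div M = i - 1"
    by (rule div_nat_eqI) (use R assms a in \<open>auto simp: mult.commute\<close>)
  ultimately have "i' = i" using assms by simp
  then show ?L using R by simp
qed auto

definition label_interval :: "'b set \<Rightarrow> ('b \<Rightarrow> nat) \<Rightarrow> 'b set \<Rightarrow> bool" where
  "label_interval V lab S \<longleftrightarrow> (\<exists>l u. \<forall>v\<in>V. v \<in> S \<longleftrightarrow> l \<le> lab v \<and> lab v < u)"

lemma traversal_labeling_nth:
  assumes "traversal_labeling m k lab" "v \<in> verts (k_rooted_sibling_tree m k)"
  obtains i j where "v = (i, sibling_tree_traversal m ! j)" "i \<in> {1..k}" "j < 2 ^ m"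
    "lab v = (i - 1) * 2 ^ m + (j + 1)"
proof -
  obtain i x where v: "v = (i, x)" "i \<in> {1..k}" "x \<in> verts (sibling_tree m)"
    using assms(2) by (auto simp: k_rooted_sibling_tree_def)
  then obtain j where "j < 2 ^ m" "x = sibling_tree_traversal m ! j"
    by (metis in_set_conv_nth length_sibling_tree_traversal set_sibling_tree_traversal)
  then show ?thesis using that v assms(1) by (simp add: traversal_labeling_def)
qed

lemma label_interval_infix:
  assumes lab: "traversal_labeling m k lab" and i: "i \<in> {1..k}"
    and t: "sibling_tree_traversal m = pre @ mid @ post"
    and S: "\<And>i' x. x \<in> verts (sibling_tree m) \<Longrightarrow> (i', x) \<in> S \<longleftrightarrow> i' = i \<and> x \<in> set mid"
  shows "label_interval (verts (k_rooted_sibling_tree m k)) lab S"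
proof -
  have len: "length pre + length mid \<le> 2 ^ m"
    using length_sibling_tree_traversal[of m] t by simp
  have "v \<in> S \<longleftrightarrow> (i - 1) * 2 ^ m + (length pre + 1) \<le> lab v \<and>
      lab v < (i - 1) * 2 ^ m + (length pre + length mid + 1)"
    if v: "v \<in> verts (k_rooted_sibling_tree m k)" for v
  proof -
    obtain i' j where v: "v = (i', sibling_tree_traversal m ! j)" "i' \<in> {1..k}" "j < 2 ^ m"
      "lab v = (i' - 1) * 2 ^ m + (j + 1)" using traversal_labeling_nth[OF lab v] .
    have "sibling_tree_traversal m ! j \<in> verts (sibling_tree m)"
      using v(3) by (metis nth_mem length_sibling_tree_traversal set_sibling_tree_traversal)
    then have "v \<in> S \<longleftrightarrow> i' = i \<and> sibling_tree_traversal m ! j \<in> set mid"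
      using S v(1) by simp
    also have "\<dots> \<longleftrightarrow> i' = i \<and> length pre \<le> j \<and> j < length pre + length mid"
      using nth_mem_infix_iff[of pre mid post j] distinct_sibling_tree_traversal[of m]
        length_sibling_tree_traversal[of m] v(3) t by simp
    also have "\<dots> \<longleftrightarrow> (i - 1) * 2 ^ m + (length pre + 1) \<le> lab v \<and>
        lab v < (i - 1) * 2 ^ m + (length pre + length mid + 1)"
      unfolding v(4) by (rule mult_add_block_iff) (use v i len in auto)
    finally show ?thesis .
  qed
  then show ?thesis unfolding label_interval_def by blast
qed

text \<open>For \<open>Subtree\<close> the labels are those of an infix of the traversal. For \<open>Below\<close> the last entry of
  that infix, the root of the subtree, is dropped. For \<open>Front\<close> they form an initial segment.\<close>

lemma label_interval_cut_side:
  assumes lab: "traversal_labeling m k lab" and c: "c \<in> sibling_cuts m k"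
  shows "label_interval (verts (k_rooted_sibling_tree m k)) lab (cut_side c)"
proof -
  let ?T = "subtree_traversal m []"
  show ?thesis
  proof (cases c rule: cut_side.cases)
    case (1 i w)
    then have i: "i \<in> {1..k}" "length w < m" using c by auto
    obtain pre post where t: "?T = pre @ subtree_traversal (m - length w) w @ post"
      using subtree_traversal_infix[of w "m - length w" "[]"] i by auto
    show ?thesis unfolding 1
    proof (rule label_interval_infix[OF lab i(1)])
      show "sibling_tree_traversal m =
          map Some pre @ map Some (subtree_traversal (m - length w) w) @ (map Some post @ [None])"
        by (simp add: sibling_tree_traversal_def t)
    qed (auto simp: set_subtree_traversal verts_sibling_tree prefix_def)
  next
    case (2 i)
    then have i: "i \<in> {1..k}" using c by auto
    show ?thesis unfolding 2
    proof (rule label_interval_infix[OF lab i])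
      show "sibling_tree_traversal m = [] @ map Some ?T @ [None]"
        by (simp add: sibling_tree_traversal_def)
    qed (auto simp: set_subtree_traversal verts_sibling_tree)
  next
    case (3 i w)
    then have i: "i \<in> {1..k}" "length w < m" using c by (auto simp: verts_sibling_tree)
    then obtain d where d: "m = length w + Suc d" by (metis less_imp_Suc_add add_Suc_right)
    let ?D = "subtree_traversal d (w @ [False]) @ subtree_traversal d (w @ [True])"
    obtain pre post where t: "?T = pre @ subtree_traversal (Suc d) w @ post"
      using subtree_traversal_infix[of w "Suc d" "[]"] d by auto
    have D: "set ?D = {v. strict_prefix w v \<and> length v < m}"
    proof -
      have "distinct (subtree_traversal (Suc d) w)" by (rule distinct_subtree_traversal)
      then have "set ?D = set (subtree_traversal (Suc d) w) - {w}" by auto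
      also have "\<dots> = {v. strict_prefix w v \<and> length v < m}"
        unfolding set_subtree_traversal by (auto simp: strict_prefix_def prefix_def d)
      finally show ?thesis .
    qed
    show ?thesis unfolding 3
    proof (rule label_interval_infix[OF lab i(1)])
      show "sibling_tree_traversal m = map Some pre @ map Some ?D @ (Some w # map Some post @ [None])"
        by (simp add: sibling_tree_traversal_def t)
    next
      fix i' x assume "x \<in> verts (sibling_tree m)"
      then show "(i', x) \<in> cut_side (Below i (Some w)) \<longleftrightarrow> i' = i \<and> x \<in> set (map Some ?D)"
        unfolding set_map D by (auto simp: verts_sibling_tree)
    qed
  next
    case (4 b i)
    then have i: "i \<in> {1..k}" using c by auto
    have "v \<in> cut_side c \<longleftrightarrow> 0 \<le> lab v \<and> lab v < i * 2 ^ m + 1"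
      if v: "v \<in> verts (k_rooted_sibling_tree m k)" for v
    proof -
      obtain i' j where v: "v = (i', sibling_tree_traversal m ! j)" "i' \<in> {1..k}" "j < 2 ^ m"
        "lab v = (i' - 1) * 2 ^ m + (j + 1)" using traversal_labeling_nth[OF lab v] .
      have "lab v < i * 2 ^ m + 1 \<longleftrightarrow> (i' - 1) * 2 ^ m + j < i * 2 ^ m" using v(4) by simp
      also have "\<dots> \<longleftrightarrow> ((i' - 1) * 2 ^ m + j) div 2 ^ m < i"
        by (rule div_less_iff_less_mult[symmetric]) simp
      also have "\<dots> \<longleftrightarrow> i' \<le> i" using v(2,3) by auto
      finally show ?thesis using v(1) 4 by simp
    qed
    then show ?thesis unfolding label_interval_def by blast
  qed
qed


section \<open>Optimality of the traversal labelling\<close>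

lemma card_verts_k_rooted_sibling_tree: "card (verts (k_rooted_sibling_tree m k)) = k * 2 ^ m"
proof -
  have "card (verts (sibling_tree m)) = 2 ^ m"
    by (metis distinct_card distinct_sibling_tree_traversal length_sibling_tree_traversal
      set_sibling_tree_traversal)
  then show ?thesis by (simp add: k_rooted_sibling_tree_def card_cartesian_product)
qed

theorem theorem2p2:
  fixes p n n1 k :: nat
    and G :: "'a graph" and Q :: "'a set set" and labG :: "'a \<Rightarrow> nat"
    and H :: "(nat \<times> bool list option) graph" and labH :: "nat \<times> bool list option \<Rightarrow> nat"
    and f :: "'a \<Rightarrow> nat \<times> bool list option"
    and P :: "'a set \<Rightarrow> (nat \<times> bool list option) list"
  assumes "p \<ge> 2" and "n \<ge> 2" and "n1 \<ge> 1" and "p \<le> n" and "n1 \<le> n"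
    and "k = 2 ^ (n - n1)"
    and "complete_multipartite G Q" and "card Q = 2 ^ p" and "\<forall>A\<in>Q. card A = 2 ^ (n - p)"
    and "bij_betw labG (verts G) {1..2 ^ n}"
    and "Q = (\<lambda>r. {v \<in> verts G. labG v mod 2 ^ p = r}) ` {..<2 ^ p}"
    and "H = k_rooted_sibling_tree n1 k"
    and "traversal_labeling n1 k labH"
    and "\<forall>v\<in>verts G. f v \<in> verts H \<and> labH (f v) = labG v"
    and "\<forall>x y. {x, y} \<in> edges G \<longrightarrow> shortest_path_between H (f x) (f y) (P {x, y})"
  shows "embedding G H f P \<and> embedding_wirelength G P = wirelength G H"
proof -
  note G = \<open>complete_multipartite G Q\<close> and labG = \<open>bij_betw labG (verts G) {1..2 ^ n}\<close>
    and labH = \<open>traversal_labeling n1 k labH\<close> and H = \<open>H = k_rooted_sibling_tree n1 k\<close>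
    and f = \<open>\<forall>v\<in>verts G. f v \<in> verts H \<and> labH (f v) = labG v\<close>
    and short = \<open>\<forall>x y. {x, y} \<in> edges G \<longrightarrow> shortest_path_between H (f x) (f y) (P {x, y})\<close>
  let ?I = "sibling_cuts n1 k"
  have simple: "simple_graph G" using G by (rule complete_multipartite_simple)
  interpret cut_representation H ?I cut_side
    unfolding H using \<open>n1 \<ge> 1\<close> by (rule cut_representation_sibling_tree)
  have "inj_on f (verts G)"
    using labG f by (auto simp: bij_betw_def inj_on_def) metis
  then have emb: "embedding G H f P"
    using f short by (auto simp: embedding_def shortest_path_between_def)
  have "card (verts H) = 2 ^ n"
    using \<open>n1 \<le> n\<close> \<open>k = _\<close> by (simp add: H card_verts_k_rooted_sibling_tree flip: power_add)
  then have card: "card (verts G) = card (verts H)"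
    using bij_betw_same_card[OF labG] by simp
  have finH: "finite (verts H)"
    using k_rooted_sibling_tree_simple[OF \<open>n1 \<ge> 1\<close>] by (simp add: H simple_graph_def)
  have bij: "bij_betw g (verts G) (verts H)" if "embedding G H g P'" for g P'
  proof -
    have "inj_on g (verts G)" "g ` verts G \<subseteq> verts H" using that by (auto simp: embedding_def)
    then show ?thesis using card finH by (metis bij_betw_def card_image card_subset_eq)
  qed
  \<comment> \<open>Cut by cut, the traversal embedding is at least as good as any other.\<close>
  have boundary_le: "card (pulled_back_boundary G f (cut_side c))
      \<le> card (pulled_back_boundary G g (cut_side c))"
    if emb': "embedding G H g P'" and c: "c \<in> ?I" for g P' c
  proof -
    obtain l u where lu: "\<And>v. v \<in> verts H \<Longrightarrow> v \<in> cut_side c \<longleftrightarrow> l \<le> labH v \<and> labH v < u"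
      using label_interval_cut_side[OF labH c] unfolding H label_interval_def by blast
    let ?A = "{x \<in> verts G. f x \<in> cut_side c}"
    have "f x \<in> cut_side c \<longleftrightarrow> l \<le> labG x \<and> labG x < u" if "x \<in> verts G" for x
      using lu[of "f x"] f that by auto
    then have "?A = {x \<in> verts G. l \<le> labG x \<and> labG x < u}" by auto
    from label_interval_balanced[OF labG _ this, of "2 ^ p"] obtain q where
      q: "\<forall>r<2 ^ p. card (?A \<inter> {x \<in> verts G. labG x mod 2 ^ p = r}) \<in> {q, q + 1}" by auto
    show ?thesis unfolding pulled_back_boundary_def
    proof (rule balanced_minimizes_edge_boundary[OF G \<open>\<forall>A\<in>Q. card A = 2 ^ (n - p)\<close>])
      show "card ?A = card {x \<in> verts G. g x \<in> cut_side c}"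
        by (simp add: card_vimage_bij_betw[OF bij[OF emb]] card_vimage_bij_betw[OF bij[OF emb']])
      show "\<forall>B\<in>Q. card (?A \<inter> B) = q \<or> card (?A \<inter> B) = q + 1"
        using q unfolding \<open>Q = _\<close> by auto
    qed auto
  qed
  have "wirelength G H = embedding_wirelength G P"
    unfolding wirelength_def
  proof (rule Least_equality)
    show "\<exists>g P'. embedding G H g P' \<and> embedding_wirelength G P' = embedding_wirelength G P"
      using emb by blast
  next
    fix w assume "\<exists>g P'. embedding G H g P' \<and> embedding_wirelength G P' = w"
    then obtain g P' where g: "embedding G H g P'" "embedding_wirelength G P' = w" by blast
    have "2 * embedding_wirelength G P \<le> (\<Sum>c\<in>?I. card (pulled_back_boundary G f (cut_side c)))"
      using simple f short by (intro wirelength_le_sum_boundaries) auto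
    also have "\<dots> \<le> (\<Sum>c\<in>?I. card (pulled_back_boundary G g (cut_side c)))"
      using boundary_le[OF g(1)] by (rule sum_mono)
    also have "\<dots> \<le> 2 * embedding_wirelength G P'"
      using simple g(1) by (rule sum_boundaries_le_wirelength)
    finally show "embedding_wirelength G P \<le> w" using g(2) by simp
  qed
  with emb show ?thesis by simp
qed

end
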